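(* Let $S=S_1+_\delta S_2$ be a gluing (by $\delta$) of MPD-semigroups $S_1=\langle a_1,\dots,a_e\rangle$ and $S_2=\langle a'_1,\dots,a'_{e'}\rangle$ in $\mathbb{N}^d$ (minimal generators) such that the defining ideals $I_{S_1}$ and $I_{S_2}$ are generated by RF-relations. Suppose there exist $f\in\mathrm{PF}(S_1)$ and $g\in\mathrm{PF}(S_2)$, factorizations $f+\delta=\sum_{j=1}^e m_ja_j$ and $g+\delta=\sum_{j=1}^{e'}m'_ja'_j$ with $m_j,m'_j\in\mathbb{N}$, and a row $(m^{(1)},\dots,m^{(e)})$ of an RF-matrix $\mathrm{RF}(f)$ of $f$ and a row $(m'^{(1)},\dots,m'^{(e')})$ of an RF-matrix $\mathrm{RF}(g)$ of $g$, such that $m_j-m^{(j)}\ge 0$ for all $j\in[1,e]$ and $m'_j-m'^{(j)}\ge0$ for all $j\in[1,e']$. Then $I_S$ is generated by RF-relations.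
   Context: $\mathbb{N}$ denotes the non-negative integers. An affine semigroup $S$ is a finitely generated submonoid of $\mathbb{N}^d$, with minimal generating set $\{a_1,\dots,a_n\}$. Put $\mathrm{cone}(S)=\{\sum_{i=1}^n\lambda_i a_i\mid \lambda_i\in\mathbb{Q}_{\ge 0}\}$ and $\mathcal{H}(S)=(\mathrm{cone}(S)\setminus S)\cap\mathbb{N}^d$. The set of pseudo-Frobenius elements is $\mathrm{PF}(S)=\{f\in\mathcal{H}(S)\mid f+s\in S \text{ for all } s\in S\setminus\{0\}\}$. $S$ is an MPD-semigroup if $\mathrm{PF}(S)\neq\emptyset$ (for $n\ge 2$ equivalently, the semigroup ring $k[S]$ has projective dimension $n-1$ over $k[x_1,\dots,x_n]$). Defining ideal: for a field $k$, $I_S$ is the kernel of the $k$-algebra map $k[x_1,\dots,x_n]\to k[t_1,\dots,t_d]$, $x_i\mapsto\mathbf{t}^{a_i}$, one variable for each minimal generator of $S$. RF-matrices: for $f\in\mathrm{PF}(S)$, an RF-matrix of $f$ is an $n\times n$ integer matrix $M=(m_{ij})$ with $m_{ii}=-1$, $m_{ij}\in\mathbb{N}$ for $i\neq j$, and $\sum_{j}m_{ij}a_j=f$ for every $i$. $\mathrm{RF}(f)$ denotes one of the possible RF-matrices of $f$. RF-relations: for $b\in\mathbb{Z}^n$ let $b^+$ be its positive part ($b^+_i=b_i$ if $b_i\ge0$, else $0$) and $b^-=b^+-b$. If $m_1,\dots,m_n$ are the rows of an RF-matrix of $f$, the binomials $\phi_{ij}=\mathbf{x}^{(m_i-m_j)^+}-\mathbf{x}^{(m_i-m_j)^-}\in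 I_S$, $i<j$, are called $\mathrm{RF}(f)$-relations. A binomial in $I_S$ is an RF-relation if it is an $\mathrm{RF}(f)$-relation for some $f\in\mathrm{PF}(S)$ (and some RF-matrix of $f$). Gluing: let $G(T)=\{a-b\mid a,b\in T\}\subseteq\mathbb{Z}^d$ be the group spanned by $T$. Let $A$ be the minimal generating set of $S$, $A=A_1\amalg A_2$ a partition into nonempty subsets, and $S_i$ the submonoid generated by $A_i$. Then $S$ is the gluing of $S_1$ and $S_2$ by $\delta$, written $S=S_1+_\delta S_2$, if $\delta\in S_1\cap S_2$ and $G(S_1)\cap G(S_2)=\delta\mathbb{Z}$. *)

theory Defs
  imports "HOL-Analysis.Analysis" "HOL-Library.Poly_Mapping"
begin

text \<open>
  Elements of $\mathbb{N}^d$ are vectors of type \<open>nat ^ 'd\<close>. A system of $n$ generators is a family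
  \<open>a :: 'n \<Rightarrow> nat ^ 'd\<close> indexed by a finite linearly ordered type \<open>'n\<close>, which plays the role of
  $\{1,\dots,n\}$.
\<close>

definition of_nat_vec :: "nat ^ 'd \<Rightarrow> 'a::semiring_1 ^ 'd" where
  "of_nat_vec v = (\<chi> i. of_nat (v $ i))"


section \<open>Affine semigroups and pseudo-Frobenius elements\<close>

definition is_submonoid :: "'a::comm_monoid_add set \<Rightarrow> bool" where
  "is_submonoid T \<longleftrightarrow> 0 \<in> T \<and> (\<forall>x\<in>T. \<forall>y\<in>T. x + y \<in> T)"

definition minimal_generating_set :: "(nat ^ 'd) set \<Rightarrow> (nat ^ 'd) set \<Rightarrow> bool" where
  "minimal_generating_set A S \<longleftrightarrow>
     is_submonoid hull A = S \<and> (\<forall>B. B \<subset> A \<longrightarrow> is_submonoid hull B \<noteq> S)"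

definition minimal_generators :: "('n::finite \<Rightarrow> nat ^ 'd) \<Rightarrow> (nat ^ 'd) set \<Rightarrow> bool" where
  "minimal_generators a S \<longleftrightarrow> inj a \<and> minimal_generating_set (range a) S"

definition affine_semigroup :: "('n::finite \<Rightarrow> nat ^ 'd) \<Rightarrow> (nat ^ 'd) set" where
  "affine_semigroup a = is_submonoid hull range a"

definition rational_cone :: "('n::finite \<Rightarrow> nat ^ 'd) \<Rightarrow> (rat ^ 'd) set" where
  "rational_cone a = {\<Sum>i\<in>UNIV. l i *s of_nat_vec (a i) | l. \<forall>i. 0 \<le> l i}"

definition holes :: "('n::finite \<Rightarrow> nat ^ 'd) \<Rightarrow> (nat ^ 'd) set" where
  "holes a = {f. of_nat_vec f \<in> rational_cone a \<and> f \<notin> affine_semigroup a}"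

definition PF :: "('n::finite \<Rightarrow> nat ^ 'd) \<Rightarrow> (nat ^ 'd) set" where
  "PF a = {f \<in> holes a. \<forall>s \<in> affine_semigroup a - {0}. f + s \<in> affine_semigroup a}"

definition MPD_semigroup :: "('n::finite \<Rightarrow> nat ^ 'd) \<Rightarrow> bool" where
  "MPD_semigroup a \<longleftrightarrow> PF a \<noteq> {}"


section \<open>The defining ideal\<close>

text \<open>
  The polynomial ring over \<open>'k\<close> in variables indexed by the finite type \<open>'n\<close> is the monoid algebra
  of $\mathbb{N}^n$: finitely supported functions on exponent vectors, with the convolution product.
\<close>

type_synonym ('n, 'k) mpoly = "(nat ^ 'n) \<Rightarrow>\<^sub>0 'k"

definition monomial :: "nat ^ 'n::finite \<Rightarrow> ('n, 'k::field) mpoly" where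
  "monomial u = Poly_Mapping.single u 1"

definition const_poly :: "'k::field \<Rightarrow> ('n::finite, 'k) mpoly" where
  "const_poly c = Poly_Mapping.single 0 c"

text \<open>The $k$-algebra homomorphism with $x_i \mapsto \mathbf{t}^{a_i}$.\<close>

definition presentation_map ::
    "('n::finite \<Rightarrow> nat ^ 'd) \<Rightarrow> ('n, 'k::field) mpoly \<Rightarrow> ('d, 'k) mpoly" where
  "presentation_map a p =
     (\<Sum>u\<in>Poly_Mapping.keys p.
        const_poly (Poly_Mapping.lookup p u) * (\<Prod>i\<in>UNIV. monomial (a i) ^ (u $ i)))"

definition defining_ideal :: "('n::finite \<Rightarrow> nat ^ 'd) \<Rightarrow> ('n, 'k::field) mpoly set" where
  "defining_ideal a = {p. presentation_map a p = 0}"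

text \<open>A commutative ring is a module over itself, and the ideal generated by a set is its span.\<close>

definition ideal_generated :: "'a::comm_ring_1 set \<Rightarrow> 'a set" where
  "ideal_generated B = module.span (*) B"


section \<open>RF-matrices and RF-relations\<close>

definition RF_matrix ::
    "('n::finite \<Rightarrow> nat ^ 'd) \<Rightarrow> nat ^ 'd \<Rightarrow> int ^ 'n ^ 'n \<Rightarrow> bool" where
  "RF_matrix a f M \<longleftrightarrow>
     (\<forall>i. M $ i $ i = -1) \<and> (\<forall>i j. i \<noteq> j \<longrightarrow> 0 \<le> M $ i $ j) \<and>
     (\<forall>i. (\<Sum>j\<in>UNIV. M $ i $ j *s of_nat_vec (a j)) = of_nat_vec f)"

definition pos_part :: "int ^ 'n \<Rightarrow> nat ^ 'n" where
  "pos_part b = (\<chi> i. if 0 \<le> b $ i then nat (b $ i) else 0)"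

definition neg_part :: "int ^ 'n \<Rightarrow> nat ^ 'n" where
  "neg_part b = (\<chi> i. nat (int (pos_part b $ i) - b $ i))"

definition RF_relations ::
    "('n::{finite,linorder} \<Rightarrow> nat ^ 'd) \<Rightarrow> ('n, 'k::field) mpoly set" where
  "RF_relations a =
     {monomial (pos_part (M $ i - M $ j)) - monomial (neg_part (M $ i - M $ j)) | f M i j.
        f \<in> PF a \<and> RF_matrix a f M \<and> i < j}"

definition generated_by_RF_relations ::
    "'k::field itself \<Rightarrow> ('n::{finite,linorder} \<Rightarrow> nat ^ 'd) \<Rightarrow> bool" where
  "generated_by_RF_relations _ a \<longleftrightarrow>
     (\<exists>B \<subseteq> RF_relations a. (defining_ideal a :: ('n, 'k) mpoly set) = ideal_generated B)"


section \<open>Gluing\<close>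

definition group_spanned :: "(nat ^ 'd) set \<Rightarrow> (int ^ 'd) set" where
  "group_spanned T = {of_nat_vec x - of_nat_vec y | x y. x \<in> T \<and> y \<in> T}"

text \<open>\<open>is_gluing S S\<^sub>1 S\<^sub>2 \<delta>\<close> is $S = S_1 +_\delta S_2$.\<close>

definition is_gluing ::
    "(nat ^ 'd) set \<Rightarrow> (nat ^ 'd) set \<Rightarrow> (nat ^ 'd) set \<Rightarrow> nat ^ 'd \<Rightarrow> bool" where
  "is_gluing S S\<^sub>1 S\<^sub>2 \<delta> \<longleftrightarrow>
     (\<exists>A\<^sub>1 A\<^sub>2. minimal_generating_set (A\<^sub>1 \<union> A\<^sub>2) S \<and> A\<^sub>1 \<inter> A\<^sub>2 = {} \<and> A\<^sub>1 \<noteq> {} \<and> A\<^sub>2 \<noteq> {} \<and>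
        S\<^sub>1 = is_submonoid hull A\<^sub>1 \<and> S\<^sub>2 = is_submonoid hull A\<^sub>2) \<and>
     \<delta> \<in> S\<^sub>1 \<and> \<delta> \<in> S\<^sub>2 \<and>
     group_spanned S\<^sub>1 \<inter> group_spanned S\<^sub>2 = range (\<lambda>z::int. z *s of_nat_vec \<delta>)"

end

theory Submission
  imports Defs
begin

text \<open>Minimal generating sets are unique, so the variables of \<open>a\<close> split into those of \<open>a\<^sub>1\<close> and
  \<open>a\<^sub>2\<close>. If $f \in \mathrm{PF}(S_1)$ and $g \in \mathrm{PF}(S_2)$, then
  $f + g + \delta \in \mathrm{PF}(S)$, and it has an RF-matrix whose rows are the rows of
  $\mathrm{RF}(f)$ extended by a factorization of $g + \delta$ and the rows of $\mathrm{RF}(g)$ extended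
  by a factorization of $f + \delta$. Differences of two rows of the same kind are the
  $\mathrm{RF}(f)$- and $\mathrm{RF}(g)$-relations. For the two given rows, the difference of rows of
  different kinds is a binomial $x^{w_2} - x^{w_1}$ made of two factorizations of $\delta$, one in
  each $S_i$. The binomials of these three types generate $I_S$: if $u = (u_1, u_2)$ and
  $v = (v_1, v_2)$ have the same degree, then
  $\deg u_1 - \deg v_1 = \deg v_2 - \deg u_2 = z \delta$ for an integer $z$, and $z$ copies of $w_1$
  can be traded for $z$ copies of $w_2$.\<close>

section \<open>Push-forward of finitely supported functions\<close>

text \<open>The additive extension of a map of exponents to finitely supported functions. It serves
  both as the presentation map and as the embedding of the polynomial ring of either part into that
  of the gluing.\<close>

definition pushforward :: "('u \<Rightarrow> 'v) \<Rightarrow> ('u \<Rightarrow>\<^sub>0 'k::comm_monoid_add) \<Rightarrow> ('v \<Rightarrow>\<^sub>0 'k)" where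
  "pushforward f p = (\<Sum>u\<in>Poly_Mapping.keys p. Poly_Mapping.single (f u) (Poly_Mapping.lookup p u))"

lemma pushforward_superset:
  assumes "finite U" "Poly_Mapping.keys p \<subseteq> U"
  shows "pushforward f p = (\<Sum>u\<in>U. Poly_Mapping.single (f u) (Poly_Mapping.lookup p u))"
  unfolding pushforward_def using assms
  by (intro sum.mono_neutral_left) (auto simp: in_keys_iff)

lemma pushforward_0 [simp]: "pushforward f 0 = 0"
  by (simp add: pushforward_def)

lemma pushforward_add: "pushforward f (p + q) = pushforward f p + pushforward f q"
proof -
  let ?U = "Poly_Mapping.keys p \<union> Poly_Mapping.keys q"
  have "Poly_Mapping.keys (p + q) \<subseteq> ?U"
    by (rule keys_add)
  then show ?thesis
    by (simp add: pushforward_superset[where U = ?U] lookup_add single_add sum.distrib)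
qed

lemma pushforward_sum: "pushforward f (sum g U) = (\<Sum>x\<in>U. pushforward f (g x))"
  by (induction U rule: infinite_finite_induct) (simp_all add: pushforward_add)

lemma pushforward_diff:
  fixes p q :: "'u \<Rightarrow>\<^sub>0 'k::ab_group_add"
  shows "pushforward f (p - q) = pushforward f p - pushforward f q"
  using pushforward_add[of f "p - q" q] by simp

lemma pushforward_single [simp]:
  "pushforward f (Poly_Mapping.single u c) = Poly_Mapping.single (f u) c"
  by (simp add: pushforward_superset[where U = "{u}"])

lemma pushforward_id: "pushforward (\<lambda>u. u) p = p"
  by (rule poly_mapping_eqI)
    (simp add: pushforward_def lookup_sum lookup_single when_def in_keys_iff)

lemma pushforward_comp: "pushforward f (pushforward g p) = pushforward (\<lambda>u. f (g u)) p"
  by (simp add: pushforward_def[of g] pushforward_sum pushforward_def[of "\<lambda>u. f (g u)"])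

text \<open>Both sides are biadditive, so it is enough to compare products of single terms, where
  additivity of \<open>f\<close> on exponents decides.\<close>

lemma pushforward_mult:
  fixes p q :: "'u::monoid_add \<Rightarrow>\<^sub>0 'k::semiring_0"
  assumes "\<And>u v. f (u + v) = f u + f v"
  shows "pushforward f (p * q) = pushforward f p * (pushforward f q :: 'v::monoid_add \<Rightarrow>\<^sub>0 'k)"
proof -
  let ?m = "\<lambda>p u. Poly_Mapping.single u (Poly_Mapping.lookup p u)"
  have expand: "p = (\<Sum>u\<in>Poly_Mapping.keys p. ?m p u)" for p :: "'u \<Rightarrow>\<^sub>0 'k"
    using pushforward_id[of p] unfolding pushforward_def by (rule sym)
  have "p * q = (\<Sum>u\<in>Poly_Mapping.keys p. ?m p u) * (\<Sum>v\<in>Poly_Mapping.keys q. ?m q v)"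
    by (rule arg_cong2[OF expand expand])
  also have "pushforward f \<dots> = pushforward f p * pushforward f q"
    by (simp add: sum_product pushforward_sum mult_single assms pushforward_def[of f p]
        pushforward_def[of f q])
  finally show ?thesis .
qed

section \<open>Ideals generated by a set\<close>

lemma module_mult: "module ((*) :: 'a::comm_ring_1 \<Rightarrow> 'a \<Rightarrow> 'a)"
  by unfold_locales (simp_all add: algebra_simps)

lemma ideal_generated_base: "x \<in> B \<Longrightarrow> x \<in> ideal_generated B"
  unfolding ideal_generated_def by (rule module.span_base[OF module_mult])

lemma ideal_generated_0: "0 \<in> ideal_generated B"
  unfolding ideal_generated_def by (rule module.span_zero[OF module_mult])

lemma ideal_generated_add:
  "x \<in> ideal_generated B \<Longrightarrow> y \<in> ideal_generated B \<Longrightarrow> x + y \<in> ideal_generated B"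
  unfolding ideal_generated_def by (rule module.span_add[OF module_mult])

lemma ideal_generated_mult: "x \<in> ideal_generated B \<Longrightarrow> c * x \<in> ideal_generated B"
  unfolding ideal_generated_def by (rule module.span_scale[OF module_mult])

lemma ideal_generated_minus: "x \<in> ideal_generated B \<Longrightarrow> - x \<in> ideal_generated B"
  unfolding ideal_generated_def by (rule module.span_neg[OF module_mult])

lemma ideal_generated_sum:
  "(\<And>x. x \<in> U \<Longrightarrow> g x \<in> ideal_generated B) \<Longrightarrow> sum g U \<in> ideal_generated B"
  unfolding ideal_generated_def by (rule module.span_sum[OF module_mult])

text \<open>The way to bound an ideal from above: \<open>T\<close> will be the kernel of a
  presentation map or the preimage of an ideal under a pushforward.\<close>

lemma ideal_generated_minimal:
  assumes "B \<subseteq> T" "0 \<in> T" "\<And>x y. x \<in> T \<Longrightarrow> y \<in> T \<Longrightarrow> x + y \<in> T" "\<And>c x. x \<in> T \<Longrightarrow> c * x \<in> T"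
  shows "ideal_generated B \<subseteq> T"
  unfolding ideal_generated_def
  using assms by (intro module.span_minimal[OF module_mult]) (auto simp: module.subspace_def[OF module_mult])

section \<open>Degrees and the defining ideal\<close>

lemma Suc_smult: "Suc k *s u = u + k *s u" for u :: "nat ^ 'd"
  by (simp add: vec_eq_iff)

text \<open>The exponent of the image of the monomial with exponent \<open>u\<close> under the
  presentation map. The vectors \<open>u\<close> of degree \<open>s\<close> are the factorizations
  of \<open>s\<close>.\<close>

definition multidegree :: "('n::finite \<Rightarrow> nat ^ 'd) \<Rightarrow> nat ^ 'n \<Rightarrow> nat ^ 'd" where
  "multidegree a u = (\<Sum>i\<in>UNIV. u $ i *s a i)"

lemma multidegree_0 [simp]: "multidegree a 0 = 0"
  by (simp add: multidegree_def)

lemma multidegree_add: "multidegree a (u + v) = multidegree a u + multidegree a v"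
  by (simp add: multidegree_def vector_sadd_rdistrib sum.distrib)

lemma multidegree_axis: "multidegree a (axis i 1) = a i"
proof -
  have "multidegree a (axis i 1) = (\<Sum>j\<in>UNIV. if j = i then a i else 0)"
    unfolding multidegree_def by (rule sum.cong) (auto simp: axis_def vec_eq_iff)
  then show ?thesis by simp
qed

lemma monomial_0: "monomial 0 = 1"
  by (simp add: monomial_def)

lemma monomial_add: "monomial (u + v) = monomial u * monomial v"
  by (simp add: monomial_def mult_single)

lemma prod_monomial_powers: "(\<Prod>i\<in>U. monomial (a i) ^ (u $ i)) = monomial (\<Sum>i\<in>U. u $ i *s a i)"
proof -
  have pow: "monomial v ^ k = monomial (k *s v)" for v and k
  proof (induction k)
    case (Suc k)
    then show ?case
      by (simp add: Suc_smult monomial_add)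
  qed (simp add: monomial_0)
  show ?thesis
    by (induction U rule: infinite_finite_induct) (simp_all add: pow monomial_0 monomial_add)
qed

text \<open>A product of powers of monomials is a monomial, so the presentation map acts on
  exponents alone.\<close>

lemma presentation_map_eq_pushforward: "presentation_map a p = pushforward (multidegree a) p"
  by (simp add: presentation_map_def pushforward_def prod_monomial_powers multidegree_def)
    (simp add: const_poly_def monomial_def mult_single)

lemma defining_ideal_eq: "defining_ideal a = {p. pushforward (multidegree a) p = 0}"
  by (simp add: defining_ideal_def presentation_map_eq_pushforward)

lemma binomial_in_defining_ideal:
  "monomial u - monomial v \<in> defining_ideal a" if "multidegree a u = multidegree a v"
  using that by (simp add: defining_ideal_eq pushforward_diff monomial_def)

text \<open>With a section \<open>\<sigma>\<close> of the multidegree map, $p = \sum_u c_u (x^u - x^{\sigma(\deg u)})$ for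
  $p = \sum_u c_u x^u$ in the kernel, because $\sum_u c_u x^{\sigma(\deg u)}$ is a pushforward of
  $\sum_u c_u t^{\deg u} = 0$.\<close>

lemma defining_ideal_subset_ideal_generated:
  fixes B :: "('n::finite, 'k::field) mpoly set"
  assumes "\<And>u v. multidegree a u = multidegree a v \<Longrightarrow> monomial u - monomial v \<in> ideal_generated B"
  shows "defining_ideal a \<subseteq> ideal_generated B"
proof
  fix p :: "('n, 'k) mpoly"
  assume p: "p \<in> defining_ideal a"
  define \<sigma> where "\<sigma> = inv_into UNIV (multidegree a)"
  let ?c = "Poly_Mapping.lookup p"
  have \<sigma>: "multidegree a u = multidegree a (\<sigma> (multidegree a u))" for u
    unfolding \<sigma>_def by (simp add: f_inv_into_f)
  have "pushforward (\<lambda>u. \<sigma> (multidegree a u)) p = 0"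
    using p by (simp add: defining_ideal_eq flip: pushforward_comp)
  then have "p = pushforward (\<lambda>u. u) p - pushforward (\<lambda>u. \<sigma> (multidegree a u)) p"
    by (simp add: pushforward_id)
  also have "\<dots> = (\<Sum>u\<in>Poly_Mapping.keys p. const_poly (?c u) *
      (monomial u - monomial (\<sigma> (multidegree a u))))"
    by (simp add: pushforward_def const_poly_def monomial_def mult_single algebra_simps sum_subtractf)
  also have "\<dots> \<in> ideal_generated B"
    by (intro ideal_generated_sum ideal_generated_mult assms \<sigma>)
  finally show "p \<in> ideal_generated B" .
qed

section \<open>Minimal generating sets\<close>

lemma is_submonoid_hull: "is_submonoid (is_submonoid hull A)"
  by (rule hull_in) (auto simp: is_submonoid_def)

lemma multidegree_in_submonoid:
  assumes "is_submonoid T" "range a \<subseteq> T"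
  shows "multidegree a u \<in> T"
proof -
  have mult: "k *s x \<in> T" if "x \<in> T" for k x
  proof (induction k)
    case (Suc k)
    with that assms(1) show ?case
      by (simp add: Suc_smult is_submonoid_def)
  qed (use assms in \<open>simp add: is_submonoid_def\<close>)
  have "(\<Sum>i\<in>U. u $ i *s a i) \<in> T" for U
    by (induction U rule: infinite_finite_induct)
      (use assms mult in \<open>auto simp: is_submonoid_def image_subset_iff\<close>)
  then show ?thesis
    by (simp add: multidegree_def)
qed

text \<open>The range of the degree map is a submonoid, and unit vectors give the generators.
  Membership thus means having a factorization.\<close>

lemma affine_semigroup_eq_range_multidegree: "affine_semigroup a = range (multidegree a)"
proof
  have "is_submonoid (range (multidegree a))"
    unfolding is_submonoid_def by (auto simp flip: multidegree_add) (metis multidegree_0 rangeI)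
  moreover have "range a \<subseteq> range (multidegree a)"
    by (metis multidegree_axis image_subsetI rangeI)
  ultimately show "affine_semigroup a \<subseteq> range (multidegree a)"
    unfolding affine_semigroup_def by (intro hull_minimal)
  show "range (multidegree a) \<subseteq> affine_semigroup a"
    unfolding affine_semigroup_def
    by (auto intro!: multidegree_in_submonoid is_submonoid_hull hull_subset)
qed

text \<open>Irreducible elements cannot be produced from others, so they lie in every generating
  set. They also generate \<open>S\<close>, so minimality leaves room for nothing else.\<close>

lemma minimal_generating_set_eq_irreducibles:
  fixes S :: "(nat ^ 'd::finite) set"
  assumes "minimal_generating_set A S"
  shows "A = {x \<in> S. x \<noteq> 0 \<and> (\<forall>y\<in>S. \<forall>z\<in>S. x = y + z \<longrightarrow> y = 0 \<or> z = 0)}"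
proof -
  define I where "I = {x \<in> S. x \<noteq> 0 \<and> (\<forall>y\<in>S. \<forall>z\<in>S. x = y + z \<longrightarrow> y = 0 \<or> z = 0)}"
  have S: "is_submonoid hull A = S" and min: "\<And>B. B \<subset> A \<Longrightarrow> is_submonoid hull B \<noteq> S"
    using assms by (simp_all add: minimal_generating_set_def)
  have sub: "0 \<in> S" "\<And>x y. x \<in> S \<Longrightarrow> y \<in> S \<Longrightarrow> x + y \<in> S"
    using is_submonoid_hull[of A] S by (simp_all add: is_submonoid_def)
  \<comment> \<open>Removing from \<open>S\<close> the irreducibles outside \<open>A\<close> leaves
    a submonoid, since a sum in \<open>S\<close> is irreducible only if one summand is 0. It
    contains \<open>A\<close>, hence is all of \<open>S\<close>.\<close>
  have "is_submonoid {x \<in> S. x \<in> I \<longrightarrow> x \<in> A}"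
    unfolding is_submonoid_def
  proof (intro conjI ballI)
    fix x y
    assume "x \<in> {x \<in> S. x \<in> I \<longrightarrow> x \<in> A}" and "y \<in> {x \<in> S. x \<in> I \<longrightarrow> x \<in> A}"
    then have *: "x \<in> S" "x \<in> I \<Longrightarrow> x \<in> A" "y \<in> S" "y \<in> I \<Longrightarrow> y \<in> A"
      by blast+
    have "x + y \<in> A" if "x + y \<in> I"
    proof -
      have "x = 0 \<or> y = 0"
        using that *(1,3) unfolding I_def by blast
      then show ?thesis
        using that *(2,4) by (elim disjE) simp_all
    qed
    then show "x + y \<in> {x \<in> S. x \<in> I \<longrightarrow> x \<in> A}"
      using sub(2)[OF *(1,3)] by blast
  qed (simp add: sub I_def)
  then have "is_submonoid hull A \<subseteq> {x \<in> S. x \<in> I \<longrightarrow> x \<in> A}"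
    by (rule hull_minimal[rotated]) (use S hull_subset[of A is_submonoid] in blast)
  then have IA: "I \<subseteq> A"
    using S by (auto simp: I_def)
  have hull_I: "0 \<in> is_submonoid hull I"
    "\<And>x y. x \<in> is_submonoid hull I \<Longrightarrow> y \<in> is_submonoid hull I \<Longrightarrow> x + y \<in> is_submonoid hull I"
    using is_submonoid_hull[of I] by (simp_all add: is_submonoid_def)
  \<comment> \<open>Descent on the coordinate sum: a reducible element splits into two nonzero ones,
    each of smaller sum.\<close>
  have "x \<in> is_submonoid hull I" if "x \<in> S" for x
    using that
  proof (induction "\<Sum>i\<in>UNIV. x $ i" arbitrary: x rule: less_induct)
    case less
    consider "x = 0" | "x \<in> I" | y z where "y \<in> S" "z \<in> S" "x = y + z" "y \<noteq> 0" "z \<noteq> 0"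
      using less.prems unfolding I_def by blast
    then show ?case
    proof cases
      case 3
      have pos: "0 < (\<Sum>i\<in>UNIV. v $ i)" if v: "v \<noteq> 0" for v :: "nat ^ 'd"
      proof (rule ccontr)
        assume "\<not> ?thesis"
        then have "v = 0"
          by (simp add: vec_eq_iff)
        with v show False ..
      qed
      have "(\<Sum>i\<in>UNIV. x $ i) = (\<Sum>i\<in>UNIV. y $ i) + (\<Sum>i\<in>UNIV. z $ i)"
        using 3(3) by (simp add: sum.distrib)
      then have "y \<in> is_submonoid hull I" "z \<in> is_submonoid hull I"
        using pos[OF 3(4)] pos[OF 3(5)] 3(1,2) by (simp_all add: less.hyps)
      with hull_I(2) 3(3) show ?thesis
        by blast
    next
      case 1
      with hull_I(1) show ?thesis by simp
    next
      case 2
      then show ?thesis by (rule hull_inc)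
    qed
  qed
  moreover have "is_submonoid hull I \<subseteq> S"
    using hull_mono[OF IA, of is_submonoid] S by simp
  ultimately have "is_submonoid hull I = S"
    by blast
  with IA min show ?thesis
    unfolding I_def by blast
qed

lemma minimal_generating_set_unique:
  fixes A B :: "(nat ^ 'd::finite) set"
  assumes "minimal_generating_set A S" "minimal_generating_set B S"
  shows "A = B"
  using minimal_generating_set_eq_irreducibles[OF assms(1)]
    minimal_generating_set_eq_irreducibles[OF assms(2)]
  by (rule trans[OF _ sym])

text \<open>If a proper subset \<open>C\<close> of \<open>A\<close> generated as much as
  \<open>A\<close>, then \<open>C \<union> B\<close> would generate \<open>S\<close>, and
  disjointness makes it a proper subset of \<open>A \<union> B\<close>.\<close>

lemma minimal_generating_set_subset:
  assumes min: "minimal_generating_set (A \<union> B) S" and disj: "A \<inter> B = {}"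
  shows "minimal_generating_set A (is_submonoid hull A)"
  unfolding minimal_generating_set_def
proof (intro conjI refl allI impI notI)
  fix C
  assume C: "C \<subset> A" and eq: "is_submonoid hull C = is_submonoid hull A"
  have "A \<subseteq> is_submonoid hull (C \<union> B)"
    using eq hull_subset[of A is_submonoid] hull_mono[of C "C \<union> B" is_submonoid] by auto
  moreover have "B \<subseteq> is_submonoid hull (C \<union> B)"
    using hull_subset[of "C \<union> B" is_submonoid] by auto
  ultimately have "is_submonoid hull (A \<union> B) \<subseteq> is_submonoid hull (C \<union> B)"
    by (intro hull_minimal is_submonoid_hull) auto
  moreover have "is_submonoid hull (C \<union> B) \<subseteq> is_submonoid hull (A \<union> B)"
    using C by (intro hull_mono) auto
  ultimately have "is_submonoid hull (C \<union> B) = S"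
    using min by (auto simp: minimal_generating_set_def)
  moreover have "C \<union> B \<subset> A \<union> B"
    using C disj by blast
  ultimately show False
    using min by (auto simp: minimal_generating_set_def)
qed

section \<open>RF-relations as lattice binomials\<close>

lemma of_nat_vec_nth [simp]: "of_nat_vec u $ i = of_nat (u $ i)"
  by (simp add: of_nat_vec_def)

lemma of_nat_vec_0 [simp]: "of_nat_vec 0 = 0"
  by (simp add: of_nat_vec_def vec_eq_iff)

lemma of_nat_vec_add [simp]: "of_nat_vec (u + v) = of_nat_vec u + of_nat_vec v"
  by (simp add: of_nat_vec_def vec_eq_iff)

lemma of_nat_vec_smult: "of_nat_vec (k *s u) = of_nat k *s of_nat_vec u"
  by (simp add: of_nat_vec_def vec_eq_iff)

lemma of_nat_vec_eq_iff [simp]: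
  "(of_nat_vec u :: 'a::{semiring_1, semiring_char_0} ^ 'd) = of_nat_vec v \<longleftrightarrow> u = v"
  by (simp add: of_nat_vec_def vec_eq_iff)

lemma of_nat_vec_sum: "of_nat_vec (sum f U) = (\<Sum>i\<in>U. of_nat_vec (f i))"
  by (induction U rule: infinite_finite_induct) simp_all

lemma of_nat_vec_multidegree:
  "of_nat_vec (multidegree a u) = (\<Sum>i\<in>UNIV. of_nat (u $ i) *s of_nat_vec (a i))"
  by (simp add: multidegree_def of_nat_vec_sum of_nat_vec_smult)

lemma neg_part_eq: "neg_part b = pos_part (- b)"
  by (simp add: neg_part_def pos_part_def vec_eq_iff)

lemma pos_part_0 [simp]: "pos_part 0 = 0"
  and pos_part_of_nat_vec [simp]: "pos_part (of_nat_vec u) = u"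
  and pos_part_minus_of_nat_vec [simp]: "pos_part (- of_nat_vec u) = 0"
  by (simp_all add: pos_part_def vec_eq_iff)

lemma neg_part_0 [simp]: "neg_part 0 = 0"
  by (simp add: neg_part_eq)

text \<open>The usual binomial of a lattice ideal attached to \<open>b\<close>; RF-relations are the
  case where \<open>b\<close> is a difference of two rows.\<close>

definition lattice_binomial :: "int ^ 'n::finite \<Rightarrow> ('n, 'k::field) mpoly" where
  "lattice_binomial b = monomial (pos_part b) - monomial (neg_part b)"

lemma lattice_binomial_minus: "lattice_binomial (- b) = - lattice_binomial b"
  by (simp add: lattice_binomial_def neg_part_eq)

lemma RF_relationsE:
  assumes "p \<in> RF_relations a"
  obtains f M i j where "f \<in> PF a" "RF_matrix a f M" "i \<noteq> j" "p = lattice_binomial (M $ i - M $ j)"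
proof -
  obtain f M i j where "f \<in> PF a" "RF_matrix a f M" "i < j" "p = lattice_binomial (M $ i - M $ j)"
    using assms unfolding RF_relations_def lattice_binomial_def by blast
  then show thesis
    by (intro that[of f M i j]) auto
qed

text \<open>Exchanging the rows only changes the sign. This removes the order condition on the
  indices, which a bijection between index types does not respect in general.\<close>

lemma lattice_binomial_rows_in_ideal_generated:
  fixes a :: "'n::{finite,linorder} \<Rightarrow> nat ^ 'd"
  assumes "f \<in> PF a" "RF_matrix a f M" "i \<noteq> j"
  shows "lattice_binomial (M $ i - M $ j) \<in> ideal_generated (RF_relations a)"
proof -
  have *: "lattice_binomial (M $ i - M $ j) \<in> ideal_generated (RF_relations a)" if "i < j" for i j
    using assms(1,2) that
    by (intro ideal_generated_base) (auto simp: RF_relations_def lattice_binomial_def)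
  show ?thesis
  proof (cases i j rule: linorder_cases)
    case greater
    have "- lattice_binomial (M $ j - M $ i) \<in> ideal_generated (RF_relations a)"
      by (rule ideal_generated_minus[OF *[OF greater]])
    then show ?thesis
      by (simp flip: lattice_binomial_minus)
  qed (use * assms(3) in auto)
qed

text \<open>Since \<open>b\<close> is its positive part minus its negative part, a linear relation
  with coefficients \<open>b\<close> becomes an equality of two degrees.\<close>

lemma multidegree_pos_neg_part:
  assumes "(\<Sum>i\<in>UNIV. b $ i *s of_nat_vec (a i)) = (0 :: int ^ 'd)"
  shows "multidegree a (pos_part b) = multidegree a (neg_part b)"
proof -
  have *: "int (pos_part b $ i) = b $ i + int (neg_part b $ i)" for i
    by (simp add: pos_part_def neg_part_def)
  have "(of_nat_vec (multidegree a (pos_part b)) :: int ^ 'd) = of_nat_vec (multidegree a (neg_part b))"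
    using assms by (simp add: of_nat_vec_multidegree * vector_sadd_rdistrib sum.distrib)
  then show ?thesis by simp
qed

text \<open>All rows of an RF-matrix evaluate to the same \<open>f\<close>, so the difference of two
  rows is a linear relation among the generators.\<close>

lemma RF_relations_subset_defining_ideal: "RF_relations a \<subseteq> defining_ideal a"
proof
  fix p assume "p \<in> RF_relations a"
  then obtain f M i j where M: "RF_matrix a f M" and p: "p = lattice_binomial (M $ i - M $ j)"
    by (rule RF_relationsE)
  have "(\<Sum>k\<in>UNIV. (M $ i - M $ j) $ k *s of_nat_vec (a k)) =
      (\<Sum>k\<in>UNIV. M $ i $ k *s of_nat_vec (a k)) - (\<Sum>k\<in>UNIV. M $ j $ k *s of_nat_vec (a k))"
    by (simp add: vector_ssub_ldistrib vec_eq_iff sum_subtractf algebra_simps)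
  also have "\<dots> = 0"
    using M by (simp add: RF_matrix_def)
  finally show "p \<in> defining_ideal a"
    unfolding p lattice_binomial_def
    by (intro binomial_in_defining_ideal multidegree_pos_neg_part)
qed

lemma ideal_generated_RF_relations_subset_defining_ideal:
  "ideal_generated (RF_relations a) \<subseteq> defining_ideal a"
  by (rule ideal_generated_minimal[OF RF_relations_subset_defining_ideal])
    (simp_all add: defining_ideal_eq pushforward_add pushforward_mult multidegree_add)

text \<open>For additive \<open>e\<close> the pushforward is multiplicative, so the preimage of an
  ideal absorbs products and only generators have to be checked.\<close>

lemma pushforward_in_ideal_generated:
  fixes e :: "nat ^ 'e::finite \<Rightarrow> nat ^ 'n::finite" and B\<^sub>1 :: "('e, 'k::field) mpoly set"
  assumes add: "\<And>u v. e (u + v) = e u + e v"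
    and base: "\<And>p. p \<in> B\<^sub>1 \<Longrightarrow> pushforward e p \<in> ideal_generated B"
    and p: "p \<in> ideal_generated B\<^sub>1"
  shows "pushforward e p \<in> ideal_generated B"
proof -
  have "ideal_generated B\<^sub>1 \<subseteq> {p. pushforward e p \<in> ideal_generated B}"
    using base by (intro ideal_generated_minimal)
      (auto simp: pushforward_add pushforward_mult[OF add] ideal_generated_0
        intro: ideal_generated_add ideal_generated_mult)
  with p show ?thesis by blast
qed

section \<open>RF-matrices of a gluing\<close>

text \<open>The vector \<open>(u, v)\<close> with its coordinates renamed along \<open>h\<close>.
  The entry type is left open in order to cover exponents, integer rows and rational
  coefficients.\<close>

definition join ::
    "('e::finite + 'e'::finite \<Rightarrow> 'n::finite) \<Rightarrow> 'a ^ 'e \<Rightarrow> 'a ^ 'e' \<Rightarrow> 'a ^ 'n" where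
  "join h u v = (\<chi> i. case inv h i of Inl j \<Rightarrow> u $ j | Inr j \<Rightarrow> v $ j)"

lemma join_Inl [simp]: "bij h \<Longrightarrow> join h u v $ h (Inl j) = u $ j"
  and join_Inr [simp]: "bij h \<Longrightarrow> join h u v $ h (Inr k) = v $ k"
  by (simp_all add: join_def bij_is_inj)

lemma bij_Plus_cases:
  assumes "bij h"
  obtains j where "i = h (Inl j)" | k where "i = h (Inr k)"
proof (cases "inv h i")
  case (Inl j)
  then show ?thesis
    using that(1)[of j] bij_inv_eq_iff[OF assms] by metis
next
  case (Inr k)
  then show ?thesis
    using that(2)[of k] bij_inv_eq_iff[OF assms] by metis
qed

lemma join_add: "join h u v + join h u' v' = join h (u + u') (v + v')"
  by (simp add: join_def vec_eq_iff split: sum.split)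

lemma join_diff: "join h u v - join h u' v' = join h (u - u') (v - v')"
  by (simp add: join_def vec_eq_iff split: sum.split)

lemma join_smult: "k *s join h u v = join h (k *s u) (k *s v)"
  by (simp add: join_def vec_eq_iff split: sum.split)

lemma join_uminus: "- join h u v = join h (- u) (- v)"
  by (simp add: join_def vec_eq_iff split: sum.split)

lemma pos_part_join: "pos_part (join h b c) = join h (pos_part b) (pos_part c)"
  by (simp add: join_def pos_part_def vec_eq_iff split: sum.split)

lemma neg_part_join: "neg_part (join h b c) = join h (neg_part b) (neg_part c)"
  by (simp add: join_def neg_part_def pos_part_def vec_eq_iff split: sum.split)

lemma join_cases:
  assumes "bij h"
  obtains u v where "w = join h u v"
proof
  show "w = join h (\<chi> j. w $ h (Inl j)) (\<chi> j. w $ h (Inr j))"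
    using assms bij_is_surj[OF assms]
    by (auto simp: join_def vec_eq_iff surj_f_inv_f split: sum.split) (metis bij_inv_eq_iff)+
qed

lemma sum_bij_Plus:
  fixes h :: "'e::finite + 'e'::finite \<Rightarrow> 'n::finite"
  assumes "bij h"
  shows "sum F UNIV = (\<Sum>j\<in>UNIV. F (h (Inl j))) + (\<Sum>k\<in>UNIV. F (h (Inr k)))"
proof -
  have "sum F UNIV = (\<Sum>s\<in>UNIV <+> UNIV. F (h s))"
    using sum.reindex_bij_betw[OF assms, of F] by simp
  also have "\<dots> = (\<Sum>j\<in>UNIV. F (h (Inl j))) + (\<Sum>k\<in>UNIV. F (h (Inr k)))"
    by (subst sum.Plus) simp_all
  finally show ?thesis .
qed

text \<open>Up to renaming along \<open>h\<close>, the block matrix with diagonal blocks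
  \<open>M\<^sub>1\<close>, \<open>M\<^sub>2\<close>, the row \<open>q\<close> repeated in the upper
  right block and \<open>p\<close> repeated in the lower left one. The repetition makes an
  off-diagonal block cancel when two rows of the same kind are subtracted.\<close>

definition glued_matrix ::
    "('e::finite + 'e'::finite \<Rightarrow> 'n::finite) \<Rightarrow> int ^ 'e ^ 'e \<Rightarrow> int ^ 'e' ^ 'e' \<Rightarrow>
      nat ^ 'e \<Rightarrow> nat ^ 'e' \<Rightarrow> int ^ 'n ^ 'n" where
  "glued_matrix h M\<^sub>1 M\<^sub>2 p q = (\<chi> i. case inv h i of
      Inl j \<Rightarrow> join h (M\<^sub>1 $ j) (of_nat_vec q) | Inr k \<Rightarrow> join h (of_nat_vec p) (M\<^sub>2 $ k))"

lemma glued_matrix_Inl [simp]: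
    "bij h \<Longrightarrow> glued_matrix h M\<^sub>1 M\<^sub>2 p q $ h (Inl j) = join h (M\<^sub>1 $ j) (of_nat_vec q)"
  and glued_matrix_Inr [simp]:
    "bij h \<Longrightarrow> glued_matrix h M\<^sub>1 M\<^sub>2 p q $ h (Inr k) = join h (of_nat_vec p) (M\<^sub>2 $ k)"
  by (simp_all add: glued_matrix_def bij_is_inj)

text \<open>The gluing with its variables already identified, through \<open>h\<close>, with the
  disjoint union of the variables of the parts. Since \<open>\<delta>\<close> is nonzero,
  \<open>f + \<delta>\<close> lies in the first semigroup and \<open>g + \<delta>\<close> in the
  second for pseudo-Frobenius \<open>f\<close> and \<open>g\<close>.\<close>

locale glued_generators =
  fixes a :: "'n::{finite,linorder} \<Rightarrow> nat ^ 'd"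
    and a\<^sub>1 :: "'e::{finite,linorder} \<Rightarrow> nat ^ 'd"
    and a\<^sub>2 :: "'e'::{finite,linorder} \<Rightarrow> nat ^ 'd"
    and h :: "'e + 'e' \<Rightarrow> 'n"
    and \<delta> :: "nat ^ 'd"
  assumes bij: "bij h"
    and a_Inl: "\<And>j. a (h (Inl j)) = a\<^sub>1 j"
    and a_Inr: "\<And>k. a (h (Inr k)) = a\<^sub>2 k"
    and \<delta>_in_1: "\<delta> \<in> affine_semigroup a\<^sub>1"
    and \<delta>_in_2: "\<delta> \<in> affine_semigroup a\<^sub>2"
    and \<delta>_nonzero: "\<delta> \<noteq> 0"
    and groups: "group_spanned (affine_semigroup a\<^sub>1) \<inter> group_spanned (affine_semigroup a\<^sub>2) =
      range (\<lambda>z::int. z *s of_nat_vec \<delta>)"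
begin

lemma sum_join:
  "(\<Sum>i\<in>UNIV. join h u v $ i *s of_nat_vec (a i)) =
    (\<Sum>j\<in>UNIV. u $ j *s of_nat_vec (a\<^sub>1 j)) + (\<Sum>k\<in>UNIV. v $ k *s of_nat_vec (a\<^sub>2 k))"
  by (simp add: sum_bij_Plus[OF bij] bij a_Inl a_Inr)

lemma multidegree_join: "multidegree a (join h u v) = multidegree a\<^sub>1 u + multidegree a\<^sub>2 v"
  by (simp add: multidegree_def sum_bij_Plus[OF bij] bij a_Inl a_Inr)

lemma affine_semigroup_cases:
  assumes "s \<in> affine_semigroup a"
  obtains s\<^sub>1 s\<^sub>2 where "s = s\<^sub>1 + s\<^sub>2" "s\<^sub>1 \<in> affine_semigroup a\<^sub>1" "s\<^sub>2 \<in> affine_semigroup a\<^sub>2"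
proof -
  obtain w where "s = multidegree a w"
    using assms by (auto simp: affine_semigroup_eq_range_multidegree)
  moreover obtain u v where "w = join h u v"
    by (rule join_cases[OF bij])
  ultimately show ?thesis
    by (intro that[of "multidegree a\<^sub>1 u" "multidegree a\<^sub>2 v"])
      (simp_all add: multidegree_join affine_semigroup_eq_range_multidegree)
qed

lemma affine_semigroup_add:
  assumes "s\<^sub>1 \<in> affine_semigroup a\<^sub>1" "s\<^sub>2 \<in> affine_semigroup a\<^sub>2"
  shows "s\<^sub>1 + s\<^sub>2 \<in> affine_semigroup a"
  using assms by (auto simp: affine_semigroup_eq_range_multidegree simp flip: multidegree_join)

lemma rational_cone_add:
  assumes "x \<in> rational_cone a\<^sub>1" "y \<in> rational_cone a\<^sub>2"
  shows "x + y \<in> rational_cone a"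
proof -
  obtain l l' where l: "\<And>j. 0 \<le> l j" "x = (\<Sum>j\<in>UNIV. l j *s of_nat_vec (a\<^sub>1 j))"
    and l': "\<And>k. 0 \<le> l' k" "y = (\<Sum>k\<in>UNIV. l' k *s of_nat_vec (a\<^sub>2 k))"
    using assms by (auto simp: rational_cone_def)
  let ?w = "join h (\<chi> j. l j) (\<chi> k. l' k)"
  have "0 \<le> ?w $ i" for i
    by (cases i rule: bij_Plus_cases[OF bij]) (simp_all add: bij l l')
  moreover have "x + y = (\<Sum>i\<in>UNIV. ?w $ i *s of_nat_vec (a i))"
    by (simp add: sum_join l l')
  ultimately show ?thesis
    unfolding rational_cone_def by (intro CollectI exI[of _ "\<lambda>i. ?w $ i"]) simp
qed

end

section \<open>Closure properties of affine semigroups and their cones\<close>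

lemma affine_semigroup_0: "0 \<in> affine_semigroup a"
  and affine_semigroup_plus:
    "x \<in> affine_semigroup a \<Longrightarrow> y \<in> affine_semigroup a \<Longrightarrow> x + y \<in> affine_semigroup a"
  using is_submonoid_hull[of "range a"] by (simp_all add: affine_semigroup_def is_submonoid_def)

lemma affine_semigroup_smult: "x \<in> affine_semigroup a \<Longrightarrow> k *s x \<in> affine_semigroup a"
proof (induction k)
  case (Suc k)
  then show ?case
    by (simp add: Suc_smult affine_semigroup_plus)
qed (simp add: affine_semigroup_0)

lemma rational_cone_plus_affine_semigroup:
  assumes "x \<in> rational_cone a" "y \<in> affine_semigroup a"
  shows "x + of_nat_vec y \<in> rational_cone a"
proof -
  obtain l where l: "\<forall>j. 0 \<le> l j" "x = (\<Sum>j\<in>UNIV. l j *s of_nat_vec (a j))"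
    using assms by (auto simp: rational_cone_def)
  obtain u where "y = multidegree a u"
    using assms by (auto simp: affine_semigroup_eq_range_multidegree)
  then have "x + of_nat_vec y = (\<Sum>j\<in>UNIV. (l j + of_nat (u $ j)) *s of_nat_vec (a j))"
    by (simp add: l of_nat_vec_multidegree vector_sadd_rdistrib sum.distrib)
  with l(1) show ?thesis
    unfolding rational_cone_def by (intro CollectI exI[of _ "\<lambda>j. l j + of_nat (u $ j)"]) simp
qed

lemma PF_plus: "f \<in> PF a \<Longrightarrow> s \<in> affine_semigroup a \<Longrightarrow> s \<noteq> 0 \<Longrightarrow> f + s \<in> affine_semigroup a"
  by (simp add: PF_def)

lemma PF_notin: "f \<in> PF a \<Longrightarrow> f \<notin> affine_semigroup a"
  by (simp add: PF_def holes_def)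

section \<open>Pseudo-Frobenius elements and RF-matrices of the gluing\<close>

context glued_generators
begin

text \<open>If the sum were \<open>s\<^sub>1 + s\<^sub>2\<close>, then
  \<open>f + \<delta> - s\<^sub>1 = s\<^sub>2 - g\<close> would lie in both groups and be a multiple
  of \<open>\<delta>\<close>. According to its sign, the multiple would put \<open>f\<close> or
  \<open>g\<close> into its own semigroup.\<close>

lemma sum_notin_affine_semigroup:
  assumes f: "f \<notin> affine_semigroup a\<^sub>1" "f + \<delta> \<in> affine_semigroup a\<^sub>1"
    and g: "g \<notin> affine_semigroup a\<^sub>2" "g + \<delta> \<in> affine_semigroup a\<^sub>2"
  shows "f + g + \<delta> \<notin> affine_semigroup a"
proof
  assume "f + g + \<delta> \<in> affine_semigroup a"
  then obtain s\<^sub>1 s\<^sub>2 where s: "f + g + \<delta> = s\<^sub>1 + s\<^sub>2"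
    "s\<^sub>1 \<in> affine_semigroup a\<^sub>1" "s\<^sub>2 \<in> affine_semigroup a\<^sub>2"
    by (rule affine_semigroup_cases)
  let ?v = "of_nat_vec :: nat ^ 'd \<Rightarrow> int ^ 'd"
  have "?v (f + g + \<delta>) = ?v (s\<^sub>1 + s\<^sub>2)"
    by (simp only: s)
  \<comment> \<open>As \<open>g\<close> is outside the second semigroup, \<open>\<delta>\<close> is
    added to both terms, which turns \<open>s\<^sub>2 - g\<close> into a difference of two
    elements.\<close>
  then have eq: "?v (f + \<delta>) - ?v s\<^sub>1 = ?v (s\<^sub>2 + \<delta>) - ?v (g + \<delta>)"
    by (simp add: algebra_simps)
  have "?v (f + \<delta>) - ?v s\<^sub>1 \<in> group_spanned (affine_semigroup a\<^sub>1)"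
    using s f unfolding group_spanned_def by blast
  moreover have "?v (f + \<delta>) - ?v s\<^sub>1 \<in> group_spanned (affine_semigroup a\<^sub>2)"
    unfolding eq using s g \<delta>_in_2 affine_semigroup_plus unfolding group_spanned_def by blast
  ultimately obtain z :: int where z: "?v (f + \<delta>) - ?v s\<^sub>1 = z *s ?v \<delta>"
    using groups by blast
  \<comment> \<open>The threshold is 1 because \<open>f = s\<^sub>1 + (z - 1) \<delta>\<close>,
    whereas \<open>g = s\<^sub>2 - z \<delta>\<close>.\<close>
  show False
  proof (cases "z \<ge> 1")
    case True
    define k where "k = nat (z - 1)"
    have "z = int k + 1"
      using True by (simp add: k_def)
    then have "?v f = ?v (s\<^sub>1 + k *s \<delta>)"
      using z by (simp add: of_nat_vec_smult vec_eq_iff algebra_simps)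
    then have "f = s\<^sub>1 + k *s \<delta>"
      by (simp only: of_nat_vec_eq_iff)
    with f(1) s(2) \<delta>_in_1 show False
      by (simp add: affine_semigroup_plus affine_semigroup_smult)
  next
    case False
    define k where "k = nat (- z)"
    have "z = - int k"
      using False by (simp add: k_def)
    have "?v g = ?v s\<^sub>2 - z *s ?v \<delta>"
      using z eq by (simp add: algebra_simps)
    also have "\<dots> = ?v (s\<^sub>2 + k *s \<delta>)"
      by (simp add: \<open>z = - int k\<close> of_nat_vec_smult vec_eq_iff)
    finally have "?v g = ?v (s\<^sub>2 + k *s \<delta>)" .
    then have "g = s\<^sub>2 + k *s \<delta>"
      by (simp only: of_nat_vec_eq_iff)
    with g(1) s(3) \<delta>_in_2 show False
      by (simp add: affine_semigroup_plus affine_semigroup_smult)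
  qed
qed

text \<open>For nonzero \<open>s = s\<^sub>1 + s\<^sub>2\<close>, a nonzero summand moves the
  pseudo-Frobenius element of its own side into the semigroup, and \<open>\<delta>\<close> is spent
  on the other side.\<close>

lemma PF_glued:
  assumes f: "f \<in> PF a\<^sub>1" and g: "g \<in> PF a\<^sub>2"
  shows "f + g + \<delta> \<in> PF a"
proof -
  have f\<delta>: "f + \<delta> \<in> affine_semigroup a\<^sub>1" and g\<delta>: "g + \<delta> \<in> affine_semigroup a\<^sub>2"
    using f g \<delta>_in_1 \<delta>_in_2 \<delta>_nonzero by (simp_all add: PF_plus)
  have "of_nat_vec f \<in> rational_cone a\<^sub>1" "of_nat_vec g \<in> rational_cone a\<^sub>2"
    using f g by (simp_all add: PF_def holes_def)
  then have "of_nat_vec f + (of_nat_vec g + of_nat_vec \<delta>) \<in> rational_cone a"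
    by (intro rational_cone_add rational_cone_plus_affine_semigroup \<delta>_in_2)
  moreover have "f + g + \<delta> \<notin> affine_semigroup a"
    using PF_notin[OF f] f\<delta> PF_notin[OF g] g\<delta> by (rule sum_notin_affine_semigroup)
  moreover have "f + g + \<delta> + s \<in> affine_semigroup a" if s: "s \<in> affine_semigroup a" "s \<noteq> 0" for s
  proof -
    obtain s\<^sub>1 s\<^sub>2 where s\<^sub>1\<^sub>2: "s = s\<^sub>1 + s\<^sub>2" "s\<^sub>1 \<in> affine_semigroup a\<^sub>1" "s\<^sub>2 \<in> affine_semigroup a\<^sub>2"
      using s(1) by (rule affine_semigroup_cases)
    show ?thesis
    proof (cases "s\<^sub>1 = 0")
      case False
      then have "(f + s\<^sub>1) + ((g + \<delta>) + s\<^sub>2) \<in> affine_semigroup a"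
        by (intro affine_semigroup_add affine_semigroup_plus PF_plus f g\<delta> s\<^sub>1\<^sub>2)
      then show ?thesis
        by (simp add: s\<^sub>1\<^sub>2 algebra_simps)
    next
      case True
      then have "s\<^sub>2 \<noteq> 0"
        using s(2) s\<^sub>1\<^sub>2(1) by simp
      then have "((f + \<delta>) + s\<^sub>1) + (g + s\<^sub>2) \<in> affine_semigroup a"
        by (intro affine_semigroup_add affine_semigroup_plus PF_plus g f\<delta> s\<^sub>1\<^sub>2)
      then show ?thesis
        by (simp add: s\<^sub>1\<^sub>2 algebra_simps)
    qed
  qed
  ultimately show ?thesis
    by (simp add: PF_def holes_def add.assoc)
qed

text \<open>Upper rows evaluate to \<open>f + (g + \<delta>)\<close> and lower rows to
  \<open>(f + \<delta>) + g\<close>. The off-diagonal blocks are factorizations, hence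
  nonnegative.\<close>

lemma RF_matrix_glued:
  assumes M\<^sub>1: "RF_matrix a\<^sub>1 f M\<^sub>1" and M\<^sub>2: "RF_matrix a\<^sub>2 g M\<^sub>2"
    and p: "multidegree a\<^sub>1 p = f + \<delta>" and q: "multidegree a\<^sub>2 q = g + \<delta>"
  shows "RF_matrix a (f + g + \<delta>) (glued_matrix h M\<^sub>1 M\<^sub>2 p q)"
proof -
  let ?M = "glued_matrix h M\<^sub>1 M\<^sub>2 p q"
  have "?M $ i $ i = -1" for i
    using M\<^sub>1 M\<^sub>2 by (cases i rule: bij_Plus_cases[OF bij]) (simp_all add: bij RF_matrix_def)
  moreover have "0 \<le> ?M $ i $ j" if "i \<noteq> j" for i j
    using that M\<^sub>1 M\<^sub>2
    by (cases i rule: bij_Plus_cases[OF bij]; cases j rule: bij_Plus_cases[OF bij])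
      (auto simp: bij RF_matrix_def inj_eq[OF bij_is_inj[OF bij]])
  moreover have "(\<Sum>j\<in>UNIV. ?M $ i $ j *s of_nat_vec (a j)) = of_nat_vec (f + g + \<delta>)" for i
    using M\<^sub>1 M\<^sub>2
    by (cases i rule: bij_Plus_cases[OF bij])
      (simp_all add: bij sum_join RF_matrix_def p q algebra_simps flip: of_nat_vec_multidegree)
  ultimately show ?thesis
    by (simp add: RF_matrix_def)
qed

end

section \<open>Binomials obtained from the rows of a glued matrix\<close>

context glued_generators
begin

lemma lattice_binomial_glued_rows:
  assumes f: "f \<in> PF a\<^sub>1" "RF_matrix a\<^sub>1 f M\<^sub>1" "multidegree a\<^sub>1 p = f + \<delta>"
    and g: "g \<in> PF a\<^sub>2" "RF_matrix a\<^sub>2 g M\<^sub>2" "multidegree a\<^sub>2 q = g + \<delta>"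
    and "i \<noteq> j"
  shows "lattice_binomial (glued_matrix h M\<^sub>1 M\<^sub>2 p q $ i - glued_matrix h M\<^sub>1 M\<^sub>2 p q $ j)
    \<in> ideal_generated (RF_relations a)"
  using PF_glued[OF f(1) g(1)] RF_matrix_glued[OF f(2) g(2) f(3) g(3)] \<open>i \<noteq> j\<close>
  by (rule lattice_binomial_rows_in_ideal_generated)

lemma PF_plus_\<delta>_multidegree_1:
  assumes "f \<in> PF a\<^sub>1"
  obtains p where "multidegree a\<^sub>1 p = f + \<delta>"
  using PF_plus[OF assms \<delta>_in_1 \<delta>_nonzero] by (auto simp: affine_semigroup_eq_range_multidegree)

lemma PF_plus_\<delta>_multidegree_2:
  assumes "g \<in> PF a\<^sub>2"
  obtains q where "multidegree a\<^sub>2 q = g + \<delta>"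
  using PF_plus[OF assms \<delta>_in_2 \<delta>_nonzero] by (auto simp: affine_semigroup_eq_range_multidegree)

text \<open>Here \<open>f\<close> and its matrix come from the relation \<open>b\<close>, while any
  \<open>g\<close> with an RF-matrix fills the other block. Two upper rows share \<open>q\<close>,
  which cancels in their difference.\<close>

lemma pushforward_RF_relations_1:
  fixes b :: "('e, 'k::field) mpoly"
  assumes b: "b \<in> RF_relations a\<^sub>1" and g: "g \<in> PF a\<^sub>2" "RF_matrix a\<^sub>2 g M\<^sub>2"
  shows "pushforward (\<lambda>u. join h u 0) b \<in> ideal_generated (RF_relations a)"
proof -
  obtain f M i j where f: "f \<in> PF a\<^sub>1" "RF_matrix a\<^sub>1 f M" and "i \<noteq> j"
    and b_eq: "b = lattice_binomial (M $ i - M $ j)"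
    using b by (rule RF_relationsE)
  obtain p where p: "multidegree a\<^sub>1 p = f + \<delta>"
    using f(1) by (rule PF_plus_\<delta>_multidegree_1)
  obtain q where q: "multidegree a\<^sub>2 q = g + \<delta>"
    using g(1) by (rule PF_plus_\<delta>_multidegree_2)
  have "h (Inl i) \<noteq> h (Inl j)"
    using \<open>i \<noteq> j\<close> bij by (simp add: bij_is_inj inj_eq)
  from lattice_binomial_glued_rows[OF f p g q this]
  have "(lattice_binomial (join h (M $ i - M $ j) 0) :: ('n, 'k) mpoly) \<in> ideal_generated (RF_relations a)"
    by (simp add: bij join_diff)
  moreover have "lattice_binomial (join h (M $ i - M $ j) 0) = pushforward (\<lambda>u. join h u 0) b"
    by (simp add: b_eq lattice_binomial_def pos_part_join neg_part_join pushforward_diff monomial_def)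
  ultimately show ?thesis by simp
qed

text \<open>The mirror case: two lower rows share \<open>p\<close>.\<close>

lemma pushforward_RF_relations_2:
  fixes b :: "('e', 'k::field) mpoly"
  assumes b: "b \<in> RF_relations a\<^sub>2" and f: "f \<in> PF a\<^sub>1" "RF_matrix a\<^sub>1 f M\<^sub>1"
  shows "pushforward (\<lambda>v. join h 0 v) b \<in> ideal_generated (RF_relations a)"
proof -
  obtain g M i j where g: "g \<in> PF a\<^sub>2" "RF_matrix a\<^sub>2 g M" and "i \<noteq> j"
    and b_eq: "b = lattice_binomial (M $ i - M $ j)"
    using b by (rule RF_relationsE)
  obtain p where p: "multidegree a\<^sub>1 p = f + \<delta>"
    using f(1) by (rule PF_plus_\<delta>_multidegree_1)
  obtain q where q: "multidegree a\<^sub>2 q = g + \<delta>"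
    using g(1) by (rule PF_plus_\<delta>_multidegree_2)
  have "h (Inr i) \<noteq> h (Inr j)"
    using \<open>i \<noteq> j\<close> bij by (simp add: bij_is_inj inj_eq)
  from lattice_binomial_glued_rows[OF f p g q this]
  have "(lattice_binomial (join h 0 (M $ i - M $ j)) :: ('n, 'k) mpoly) \<in> ideal_generated (RF_relations a)"
    by (simp add: bij join_diff)
  moreover have "lattice_binomial (join h 0 (M $ i - M $ j)) = pushforward (\<lambda>v. join h 0 v) b"
    by (simp add: b_eq lattice_binomial_def pos_part_join neg_part_join pushforward_diff monomial_def)
  ultimately show ?thesis by simp
qed

text \<open>The rows \<open>r\<close> and \<open>r'\<close> of the glued matrix are $(M_r, q)$ and $(p, M'_{r'})$; their difference
  has positive part $q - M'_{r'}$ and negative part $p - M_r$, which are factorizations of $\delta$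
  in the two semigroups.\<close>

lemma \<delta>_binomial:
  assumes f: "f \<in> PF a\<^sub>1" "RF_matrix a\<^sub>1 f M" "multidegree a\<^sub>1 p = f + \<delta>"
    and g: "g \<in> PF a\<^sub>2" "RF_matrix a\<^sub>2 g M'" "multidegree a\<^sub>2 q = g + \<delta>"
    and le: "\<And>j. M $ r $ j \<le> int (p $ j)" "\<And>k. M' $ r' $ k \<le> int (q $ k)"
  obtains w\<^sub>1 w\<^sub>2 where "multidegree a\<^sub>1 w\<^sub>1 = \<delta>" "multidegree a\<^sub>2 w\<^sub>2 = \<delta>"
    "(monomial (join h 0 w\<^sub>2) - monomial (join h w\<^sub>1 0) :: ('n, 'k::field) mpoly)
      \<in> ideal_generated (RF_relations a)"
proof
  \<comment> \<open>By \<open>le\<close> both differences are nonnegative, so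
    \<open>pos_part\<close> merely turns them into vectors of naturals.\<close>
  define w\<^sub>1 where "w\<^sub>1 = pos_part (of_nat_vec p - M $ r)"
  define w\<^sub>2 where "w\<^sub>2 = pos_part (of_nat_vec q - M' $ r')"
  have w\<^sub>1: "int (w\<^sub>1 $ j) = int (p $ j) - M $ r $ j" for j
    using le(1)[of j] by (simp add: w\<^sub>1_def pos_part_def)
  have w\<^sub>2: "int (w\<^sub>2 $ k) = int (q $ k) - M' $ r' $ k" for k
    using le(2)[of k] by (simp add: w\<^sub>2_def pos_part_def)
  have "of_nat_vec (multidegree a\<^sub>1 w\<^sub>1) = of_nat_vec (multidegree a\<^sub>1 p) - (of_nat_vec f :: int ^ 'd)"
    using f(2) unfolding of_nat_vec_multidegree w\<^sub>1
    by (simp add: RF_matrix_def vector_sub_rdistrib sum_subtractf)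
  then have "of_nat_vec (multidegree a\<^sub>1 w\<^sub>1) = (of_nat_vec \<delta> :: int ^ 'd)"
    by (simp add: f(3))
  then show "multidegree a\<^sub>1 w\<^sub>1 = \<delta>" by simp
  have "of_nat_vec (multidegree a\<^sub>2 w\<^sub>2) = of_nat_vec (multidegree a\<^sub>2 q) - (of_nat_vec g :: int ^ 'd)"
    using g(2) unfolding of_nat_vec_multidegree w\<^sub>2
    by (simp add: RF_matrix_def vector_sub_rdistrib sum_subtractf)
  then have "of_nat_vec (multidegree a\<^sub>2 w\<^sub>2) = (of_nat_vec \<delta> :: int ^ 'd)"
    by (simp add: g(3))
  then show "multidegree a\<^sub>2 w\<^sub>2 = \<delta>" by simp
  have "h (Inl r) \<noteq> h (Inr r')"
    using bij by (simp add: bij_is_inj inj_eq)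
  note lattice_binomial_glued_rows[OF f g this]
  also have "glued_matrix h M M' p q $ h (Inl r) - glued_matrix h M M' p q $ h (Inr r') =
      join h (- of_nat_vec w\<^sub>1) (of_nat_vec w\<^sub>2)"
    by (simp add: bij join_diff) (simp add: join_def vec_eq_iff w\<^sub>1 w\<^sub>2 split: sum.split)
  also have "lattice_binomial \<dots> = monomial (join h 0 w\<^sub>2) - monomial (join h w\<^sub>1 0)"
    by (simp add: lattice_binomial_def neg_part_eq join_uminus pos_part_join)
  finally show "(monomial (join h 0 w\<^sub>2) - monomial (join h w\<^sub>1 0) :: ('n, 'k) mpoly)
      \<in> ideal_generated (RF_relations a)" .
qed

end

section \<open>The defining ideal of a gluing\<close>

text \<open>The congruence on exponents induced by the ideal; it turns membership of binomials into
  chains of moves between exponents.\<close>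

definition congruent_monomials ::
    "('n::finite, 'k::field) mpoly set \<Rightarrow> nat ^ 'n \<Rightarrow> nat ^ 'n \<Rightarrow> bool" where
  "congruent_monomials B u v \<longleftrightarrow> monomial u - monomial v \<in> ideal_generated B"

lemma congruent_monomials_refl: "congruent_monomials B u u"
  by (simp add: congruent_monomials_def ideal_generated_0)

lemma congruent_monomials_sym: "congruent_monomials B u v \<Longrightarrow> congruent_monomials B v u"
  unfolding congruent_monomials_def
  using ideal_generated_minus[of "monomial u - monomial v" B] by simp

lemma congruent_monomials_trans [trans]:
  "congruent_monomials B u v \<Longrightarrow> congruent_monomials B v w \<Longrightarrow> congruent_monomials B u w"
  unfolding congruent_monomials_def
  using ideal_generated_add[of "monomial u - monomial v" B "monomial v - monomial w"] by simp

lemma congruent_monomials_add: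
  fixes B :: "('n::finite, 'k::field) mpoly set"
  assumes "congruent_monomials B u v" "congruent_monomials B u' v'"
  shows "congruent_monomials B (u + u') (v + v')"
proof -
  \<comment> \<open>The difference telescopes through the intermediate exponent
    \<open>v + u'\<close>.\<close>
  have "(monomial (u + u') - monomial (v + v') :: ('n, 'k) mpoly) =
      monomial u' * (monomial u - monomial v) + monomial v * (monomial u' - monomial v')"
    by (simp add: monomial_add algebra_simps)
  also have "\<dots> \<in> ideal_generated B"
    using assms unfolding congruent_monomials_def
    by (intro ideal_generated_add ideal_generated_mult)
  finally show ?thesis
    by (simp add: congruent_monomials_def)
qed

lemma congruent_monomials_smult:
  assumes "congruent_monomials B u v"
  shows "congruent_monomials B (k *s u) (k *s v)"
proof (induction k)
  case (Suc k)
  then show ?case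
    using congruent_monomials_add[OF assms] by (simp add: Suc_smult)
qed (simp add: congruent_monomials_refl)

lemma multidegree_smult: "multidegree a (k *s u) = k *s multidegree a u"
proof (induction k)
  case (Suc k)
  then show ?case
    by (simp add: Suc_smult multidegree_add)
qed simp

text \<open>Three moves: within the first part replace \<open>u\<^sub>1\<close> by
  \<open>v\<^sub>1 + k w\<^sub>1\<close>, trade \<open>k w\<^sub>1\<close> for
  \<open>k w\<^sub>2\<close>, and within the second part replace
  \<open>u\<^sub>2 + k w\<^sub>2\<close> by \<open>v\<^sub>2\<close>.\<close>

lemma (in glued_generators) congruent_of_multidegree_shift:
  assumes ker\<^sub>1: "\<And>u v. multidegree a\<^sub>1 u = multidegree a\<^sub>1 v \<Longrightarrow>
      congruent_monomials B (join h u 0) (join h v 0)"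
    and ker\<^sub>2: "\<And>u v. multidegree a\<^sub>2 u = multidegree a\<^sub>2 v \<Longrightarrow>
      congruent_monomials B (join h 0 u) (join h 0 v)"
    and w: "multidegree a\<^sub>1 w\<^sub>1 = \<delta>" "multidegree a\<^sub>2 w\<^sub>2 = \<delta>"
      "congruent_monomials B (join h w\<^sub>1 0) (join h 0 w\<^sub>2)"
    and u\<^sub>1: "multidegree a\<^sub>1 u\<^sub>1 = multidegree a\<^sub>1 v\<^sub>1 + k *s \<delta>"
    and v\<^sub>2: "multidegree a\<^sub>2 v\<^sub>2 = multidegree a\<^sub>2 u\<^sub>2 + k *s \<delta>"
  shows "congruent_monomials B (join h u\<^sub>1 u\<^sub>2) (join h v\<^sub>1 v\<^sub>2)"
proof -
  have split: "join h u v = join h u 0 + join h 0 v" for u :: "nat ^ 'e::{finite,linorder}" and v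
    by (simp add: join_add)
  have smult: "join h (k *s w\<^sub>1) 0 = k *s join h w\<^sub>1 0" "join h 0 (k *s w\<^sub>2) = k *s join h 0 w\<^sub>2"
    by (simp_all add: join_smult)
  have "congruent_monomials B (join h u\<^sub>1 u\<^sub>2) (join h (v\<^sub>1 + k *s w\<^sub>1) 0 + join h 0 u\<^sub>2)"
    unfolding split[of u\<^sub>1 u\<^sub>2] using u\<^sub>1 w
    by (intro congruent_monomials_add ker\<^sub>1 congruent_monomials_refl)
      (simp add: multidegree_add multidegree_smult)
  also have "join h (v\<^sub>1 + k *s w\<^sub>1) 0 + join h 0 u\<^sub>2 = join h v\<^sub>1 u\<^sub>2 + k *s join h w\<^sub>1 0"
    by (simp add: join_add flip: smult)
  also have "congruent_monomials B \<dots> (join h v\<^sub>1 u\<^sub>2 + k *s join h 0 w\<^sub>2)"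
    by (intro congruent_monomials_add congruent_monomials_smult congruent_monomials_refl w)
  also have "join h v\<^sub>1 u\<^sub>2 + k *s join h 0 w\<^sub>2 = join h v\<^sub>1 0 + join h 0 (u\<^sub>2 + k *s w\<^sub>2)"
    by (simp add: join_add flip: smult)
  also have "congruent_monomials B \<dots> (join h v\<^sub>1 v\<^sub>2)"
    unfolding split[of v\<^sub>1 v\<^sub>2] using v\<^sub>2 w
    by (intro congruent_monomials_add ker\<^sub>2 congruent_monomials_refl)
      (simp add: multidegree_add multidegree_smult)
  finally show ?thesis .
qed

text \<open>The binomial of \<open>u\<close> and \<open>v\<close> lies in the defining ideal of the
  part, which its RF-relations generate, so control of their images under \<open>e\<close>
  suffices.\<close>

lemma congruent_monomials_pushforward:
  fixes e :: "nat ^ 'e::{finite,linorder} \<Rightarrow> nat ^ 'n::finite"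
  assumes gen: "generated_by_RF_relations TYPE('k::field) a\<^sub>1"
    and add: "\<And>u v. e (u + v) = e u + e v"
    and base: "\<And>p. p \<in> RF_relations a\<^sub>1 \<Longrightarrow> pushforward e p \<in> ideal_generated B"
    and uv: "multidegree a\<^sub>1 u = multidegree a\<^sub>1 v"
  shows "congruent_monomials (B :: ('n, 'k) mpoly set) (e u) (e v)"
proof -
  obtain B\<^sub>1 :: "('e, 'k) mpoly set"
    where B\<^sub>1: "B\<^sub>1 \<subseteq> RF_relations a\<^sub>1" "defining_ideal a\<^sub>1 = ideal_generated B\<^sub>1"
    using gen unfolding generated_by_RF_relations_def by blast
  have "(monomial u - monomial v :: ('e, 'k) mpoly) \<in> ideal_generated B\<^sub>1"
    using binomial_in_defining_ideal[OF uv] B\<^sub>1(2) by metis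
  then have "pushforward e (monomial u - monomial v) \<in> ideal_generated B"
    by (rule pushforward_in_ideal_generated[OF add, rotated]) (use B\<^sub>1(1) base in blast)
  then show ?thesis
    by (simp add: congruent_monomials_def pushforward_diff monomial_def)
qed

theorem (in glued_generators) generated_by_RF_relations_glued:
  assumes gen: "generated_by_RF_relations TYPE('k::field) a\<^sub>1"
      "generated_by_RF_relations TYPE('k) a\<^sub>2"
    and f: "f \<in> PF a\<^sub>1" "RF_matrix a\<^sub>1 f M" "multidegree a\<^sub>1 p = f + \<delta>"
    and g: "g \<in> PF a\<^sub>2" "RF_matrix a\<^sub>2 g M'" "multidegree a\<^sub>2 q = g + \<delta>"
    and le: "\<And>j. M $ r $ j \<le> int (p $ j)" "\<And>k. M' $ r' $ k \<le> int (q $ k)"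
  shows "generated_by_RF_relations TYPE('k) a"
proof -
  let ?B = "RF_relations a :: ('n, 'k) mpoly set"
  \<comment> \<open>Exponents of equal degree within one part stay congruent in the gluing; the
    given element and matrix of the other part supply the missing block.\<close>
  have ker\<^sub>1: "congruent_monomials ?B (join h u 0) (join h v 0)"
    if "multidegree a\<^sub>1 u = multidegree a\<^sub>1 v" for u v
    using gen(1) by (rule congruent_monomials_pushforward[where e = "\<lambda>u. join h u 0"])
      (use that pushforward_RF_relations_1[OF _ g(1,2)] in \<open>simp_all add: join_add\<close>)
  have ker\<^sub>2: "congruent_monomials ?B (join h 0 u) (join h 0 v)"
    if "multidegree a\<^sub>2 u = multidegree a\<^sub>2 v" for u v
    using gen(2) by (rule congruent_monomials_pushforward[where e = "\<lambda>v. join h 0 v"])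
      (use that pushforward_RF_relations_2[OF _ f(1,2)] in \<open>simp_all add: join_add\<close>)
  obtain w\<^sub>1 w\<^sub>2 where w: "multidegree a\<^sub>1 w\<^sub>1 = \<delta>" "multidegree a\<^sub>2 w\<^sub>2 = \<delta>"
    and "monomial (join h 0 w\<^sub>2) - monomial (join h w\<^sub>1 0) \<in> ideal_generated ?B"
    by (rule \<delta>_binomial[OF f g le])
  then have "congruent_monomials ?B (join h w\<^sub>1 0) (join h 0 w\<^sub>2)"
    by (intro congruent_monomials_sym[of ?B "join h 0 w\<^sub>2"]) (simp add: congruent_monomials_def)
  note shift = congruent_of_multidegree_shift[OF ker\<^sub>1 ker\<^sub>2 w this]
  \<comment> \<open>Binomials suffice by
    \<open>defining_ideal_subset_ideal_generated\<close>.\<close>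
  have "congruent_monomials ?B u v" if uv: "multidegree a u = multidegree a v" for u v
  proof -
    obtain u\<^sub>1 u\<^sub>2 where u: "u = join h u\<^sub>1 u\<^sub>2"
      by (rule join_cases[OF bij])
    obtain v\<^sub>1 v\<^sub>2 where v: "v = join h v\<^sub>1 v\<^sub>2"
      by (rule join_cases[OF bij])
    let ?d\<^sub>1 = "\<lambda>u. of_nat_vec (multidegree a\<^sub>1 u) :: int ^ 'd"
    let ?d\<^sub>2 = "\<lambda>u. of_nat_vec (multidegree a\<^sub>2 u) :: int ^ 'd"
    have "of_nat_vec (multidegree a u) = (of_nat_vec (multidegree a v) :: int ^ 'd)"
      using uv by simp
    \<comment> \<open>What the first part loses in degree the second part gains, so this common
      difference lies in both groups and is a multiple of \<open>\<delta>\<close>.\<close>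
    then have eq: "?d\<^sub>1 u\<^sub>1 - ?d\<^sub>1 v\<^sub>1 = ?d\<^sub>2 v\<^sub>2 - ?d\<^sub>2 u\<^sub>2"
      unfolding u v multidegree_join by (simp add: algebra_simps)
    have "?d\<^sub>1 u\<^sub>1 - ?d\<^sub>1 v\<^sub>1 \<in> group_spanned (affine_semigroup a\<^sub>1)"
      unfolding group_spanned_def affine_semigroup_eq_range_multidegree by blast
    moreover have "?d\<^sub>1 u\<^sub>1 - ?d\<^sub>1 v\<^sub>1 \<in> group_spanned (affine_semigroup a\<^sub>2)"
      unfolding eq group_spanned_def affine_semigroup_eq_range_multidegree by blast
    ultimately obtain z :: int where z\<^sub>1: "?d\<^sub>1 u\<^sub>1 - ?d\<^sub>1 v\<^sub>1 = z *s of_nat_vec \<delta>"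
      using groups by blast
    with eq have z\<^sub>2: "?d\<^sub>2 v\<^sub>2 - ?d\<^sub>2 u\<^sub>2 = z *s of_nat_vec \<delta>"
      by simp
    have step: "x = y + k *s \<delta>"
      if "of_nat_vec x - of_nat_vec y = int k *s of_nat_vec \<delta>" for x y k
    proof -
      have "of_nat_vec x = (of_nat_vec (y + k *s \<delta>) :: int ^ 'd)"
        using that by (simp add: of_nat_vec_smult algebra_simps)
      then show ?thesis
        by (simp only: of_nat_vec_eq_iff)
    qed
    show ?thesis
    proof (cases "z \<ge> 0")
      case True
      then obtain k where z: "z = int k"
        by (rule nonneg_int_cases)
      show ?thesis
        unfolding u v
      proof (rule shift)
        show "multidegree a\<^sub>1 u\<^sub>1 = multidegree a\<^sub>1 v\<^sub>1 + k *s \<delta>"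
          using z\<^sub>1 unfolding z by (rule step)
        show "multidegree a\<^sub>2 v\<^sub>2 = multidegree a\<^sub>2 u\<^sub>2 + k *s \<delta>"
          using z\<^sub>2 unfolding z by (rule step)
      qed
    next
      case False
      then obtain k where z: "- z = int k"
        by (metis nonneg_int_cases linear neg_0_le_iff_le)
      have neg: "x - y = int k *s of_nat_vec \<delta>" if "y - x = z *s of_nat_vec \<delta>" for x y :: "int ^ 'd"
        using that unfolding z[symmetric] by (simp add: vec_eq_iff algebra_simps)
      \<comment> \<open>For negative \<open>z\<close> the shift leads from \<open>v\<close> to
        \<open>u\<close>; symmetry of the congruence then restores the order.\<close>
      have "congruent_monomials ?B (join h v\<^sub>1 v\<^sub>2) (join h u\<^sub>1 u\<^sub>2)"
      proof (rule shift)
        show "multidegree a\<^sub>1 v\<^sub>1 = multidegree a\<^sub>1 u\<^sub>1 + k *s \<delta>"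
          by (rule step[OF neg[OF z\<^sub>1]])
        show "multidegree a\<^sub>2 u\<^sub>2 = multidegree a\<^sub>2 v\<^sub>2 + k *s \<delta>"
          by (rule step[OF neg[OF z\<^sub>2]])
      qed
      then show ?thesis
        unfolding u v by (rule congruent_monomials_sym)
    qed
  qed
  then have "defining_ideal a \<subseteq> ideal_generated ?B"
    by (intro defining_ideal_subset_ideal_generated) (simp add: congruent_monomials_def)
  then have "defining_ideal a = ideal_generated ?B"
    using ideal_generated_RF_relations_subset_defining_ideal by blast
  then show ?thesis
    unfolding generated_by_RF_relations_def by blast
qed

section \<open>Matching the given generators with the gluing\<close>

lemma bij_case_sum_generators:
  fixes a :: "'n::finite \<Rightarrow> 'x" and a\<^sub>1 :: "'e::finite \<Rightarrow> 'x" and a\<^sub>2 :: "'e'::finite \<Rightarrow> 'x"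
  assumes "inj a" "inj a\<^sub>1" "inj a\<^sub>2" "range a = range a\<^sub>1 \<union> range a\<^sub>2" "range a\<^sub>1 \<inter> range a\<^sub>2 = {}"
  obtains h where "bij h" "\<And>j. a (h (Inl j)) = a\<^sub>1 j" "\<And>k. a (h (Inr k)) = a\<^sub>2 k"
proof
  \<comment> \<open>Each generator of a part is sent to the index at which \<open>a\<close> lists
    it; disjoint ranges keep this injective.\<close>
  define h where "h = (\<lambda>s. inv a (case_sum a\<^sub>1 a\<^sub>2 s))"
  have a_h: "a (h s) = case_sum a\<^sub>1 a\<^sub>2 s" for s
    unfolding h_def by (rule f_inv_into_f) (use assms(4) in \<open>auto split: sum.split\<close>)
  from a_h show "a (h (Inl j)) = a\<^sub>1 j" "a (h (Inr k)) = a\<^sub>2 k" for j k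
    by simp_all
  have "inj (case_sum a\<^sub>1 a\<^sub>2)"
    using assms(2,3,5) by (auto simp: inj_def split: sum.splits) (metis disjoint_iff rangeI)+
  then have "inj h"
    using inj_on_imageI2[of a h UNIV] by (simp add: comp_def a_h)
  moreover have "surj h"
  proof -
    have "\<exists>s. i = h s" for i
    proof -
      have "a i \<in> range a\<^sub>1 \<union> range a\<^sub>2"
        using assms(4) by blast
      then obtain s where "a i = case_sum a\<^sub>1 a\<^sub>2 s"
        by (auto intro: that[of "Inl _"] that[of "Inr _"])
      then have "a i = a (h s)"
        by (simp add: a_h)
      then have "i = h s"
        by (rule injD[OF assms(1)])
      then show ?thesis ..
    qed
    then show ?thesis
      by (simp add: surj_def)
  qed
  ultimately show "bij h"
    by (simp add: bij_def)
qed

theorem theorem5p11: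
  fixes a :: "'n::{finite,linorder} \<Rightarrow> nat ^ 'd"
    and a\<^sub>1 :: "'e::{finite,linorder} \<Rightarrow> nat ^ 'd"
    and a\<^sub>2 :: "'e'::{finite,linorder} \<Rightarrow> nat ^ 'd"
    and S S\<^sub>1 S\<^sub>2 :: "(nat ^ 'd) set"
    and \<delta> f g :: "nat ^ 'd"
    and m :: "'e \<Rightarrow> nat" and m' :: "'e' \<Rightarrow> nat"
    and M :: "int ^ 'e::{finite,linorder} ^ 'e::{finite,linorder}"
    and M' :: "int ^ 'e'::{finite,linorder} ^ 'e'::{finite,linorder}"
    and r :: 'e and r' :: 'e'
  assumes "is_gluing S S\<^sub>1 S\<^sub>2 \<delta>"
    and "minimal_generators a S"
    and "minimal_generators a\<^sub>1 S\<^sub>1"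
    and "minimal_generators a\<^sub>2 S\<^sub>2"
    and "MPD_semigroup a\<^sub>1"
    and "MPD_semigroup a\<^sub>2"
    and "generated_by_RF_relations TYPE('k::field) a\<^sub>1"
    and "generated_by_RF_relations TYPE('k) a\<^sub>2"
    and "f \<in> PF a\<^sub>1"
    and "g \<in> PF a\<^sub>2"
    and "f + \<delta> = (\<Sum>j\<in>UNIV. m j *s a\<^sub>1 j)"
    and "g + \<delta> = (\<Sum>j\<in>UNIV. m' j *s a\<^sub>2 j)"
    and "RF_matrix a\<^sub>1 f M"
    and "RF_matrix a\<^sub>2 g M'"
    and "\<forall>j. int (m j) - M $ r $ j \<ge> 0"
    and "\<forall>j. int (m' j) - M' $ r' $ j \<ge> 0"
  shows "generated_by_RF_relations TYPE('k) a"
proof -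
  obtain A\<^sub>1 A\<^sub>2 where A: "minimal_generating_set (A\<^sub>1 \<union> A\<^sub>2) S" "A\<^sub>1 \<inter> A\<^sub>2 = {}"
    and S\<^sub>1: "S\<^sub>1 = is_submonoid hull A\<^sub>1" and S\<^sub>2: "S\<^sub>2 = is_submonoid hull A\<^sub>2"
    and \<delta>: "\<delta> \<in> S\<^sub>1" "\<delta> \<in> S\<^sub>2"
    and groups: "group_spanned S\<^sub>1 \<inter> group_spanned S\<^sub>2 = range (\<lambda>z::int. z *s of_nat_vec \<delta>)"
    using assms(1) unfolding is_gluing_def by blast
  have A\<^sub>1: "minimal_generating_set A\<^sub>1 S\<^sub>1"
    unfolding S\<^sub>1 using A by (rule minimal_generating_set_subset)
  have A\<^sub>2: "minimal_generating_set A\<^sub>2 S\<^sub>2"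
    unfolding S\<^sub>2 using A
    by (intro minimal_generating_set_subset[of A\<^sub>2 A\<^sub>1 S]) (simp_all add: Un_commute Int_commute)
  have gens: "minimal_generating_set (range a) S" "minimal_generating_set (range a\<^sub>1) S\<^sub>1"
    "minimal_generating_set (range a\<^sub>2) S\<^sub>2"
    using assms(2-4) by (simp_all add: minimal_generators_def)
  \<comment> \<open>The definition of a gluing only provides some sets of generators; uniqueness
    identifies them with the ranges of the given families.\<close>
  note ranges = minimal_generating_set_unique[OF gens(1) A(1)]
    minimal_generating_set_unique[OF gens(2) A\<^sub>1] minimal_generating_set_unique[OF gens(3) A\<^sub>2]
  have inj: "inj a" "inj a\<^sub>1" "inj a\<^sub>2"
    using assms(2-4) by (simp_all add: minimal_generators_def)
  have ranges_split: "range a = range a\<^sub>1 \<union> range a\<^sub>2" "range a\<^sub>1 \<inter> range a\<^sub>2 = {}"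
    by (simp_all only: ranges A(2))
  obtain h where h: "bij h" "\<And>j. a (h (Inl j)) = a\<^sub>1 j" "\<And>k. a (h (Inr k)) = a\<^sub>2 k"
    using bij_case_sum_generators[OF inj ranges_split] by blast
  have S: "affine_semigroup a\<^sub>1 = S\<^sub>1" "affine_semigroup a\<^sub>2 = S\<^sub>2"
    by (simp_all add: affine_semigroup_def ranges S\<^sub>1 S\<^sub>2)
  have deg: "multidegree a\<^sub>1 (\<chi> j. m j) = f + \<delta>" "multidegree a\<^sub>2 (\<chi> j. m' j) = g + \<delta>"
    using assms(11,12) by (simp_all add: multidegree_def)
  \<comment> \<open>The factorization puts \<open>f + \<delta>\<close> into the first semigroup,
    which does not contain \<open>f\<close>; hence \<open>\<delta>\<close> is nonzero.\<close>
  have "f + \<delta> \<in> affine_semigroup a\<^sub>1"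
    unfolding affine_semigroup_eq_range_multidegree deg(1)[symmetric] by simp
  then have "\<delta> \<noteq> 0"
    using PF_notin[OF assms(9)] by auto
  interpret glued_generators a a\<^sub>1 a\<^sub>2 h \<delta>
    by unfold_locales (use h \<delta> S groups \<open>\<delta> \<noteq> 0\<close> in simp_all)
  show ?thesis
    by (rule generated_by_RF_relations_glued[OF assms(7,8,9,13) deg(1) assms(10,14) deg(2),
          where r = r and r' = r'])
      (use assms(15,16) in simp_all)
qed

end
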